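(* There exist a representation $\delta:\subseteq\{0,1\}^\omega\to\{0,1\}^\omega$ of Cantor space (computably equivalent to the identity representation) and a $\mathbb{T}^\omega$-representation $\psi:\subseteq\mathbb{T}^\omega\to\mathcal{K}(\{0,1\}^\omega)$ of $\mathcal{K}(\{0,1\}^\omega)$ (i.e.\ $\psi\circ\delta_{\mathbb{T}^\omega}$ is computably equivalent to the standard representation of $\mathcal{K}(\{0,1\}^\omega)$) which match: for all $A\in\mathcal{K}(\{0,1\}^\omega)$ and $x\in\{0,1\}^\omega$, $$x\in A\iff\forall p\in\psi^{-1}(A)\ \exists q\in\{0,1\}^\omega\ (p\preceq q\wedge\delta(q)=x)\iff\exists p\in\psi^{-1}(A)\ \exists q\in\{0,1\}^\omega\ (p\preceq q\wedge\delta(q)=x).$$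
   Context: Plotkin's $\mathbb{T}=\{0,1,\bot\}$ is represented by $\delta_\mathbb{T}(0^\omega)=\bot$, $\delta_\mathbb{T}(p)=0$ if $\min\{n\mid p(n)=1\}$ is even and $1$ if odd; $\mathbb{T}^\omega$ (infinite sequences over $\mathbb{T}$) carries the induced product representation $\delta_{\mathbb{T}^\omega}$. A $\mathbb{T}^\omega$-representation of a set $Y$ is a partial surjection $\psi:\subseteq\mathbb{T}^\omega\to Y$. For $p,q\in\mathbb{T}^\omega$, $p\preceq q$ means $p(n)\neq\bot\Rightarrow p(n)=q(n)$ for all $n$; $\{0,1\}^\omega\subseteq\mathbb{T}^\omega$. Representations are partial surjections from $\{0,1\}^\omega$; computable equivalence means the identity is computable in both directions. The standard representation of $\mathcal{K}(\mathbf{X})$ represents a compact $A$ by $\{U\in\mathcal{O}(\mathbf{X})\mid A\subseteq U\}\in\mathcal{O}(\mathcal{O}(\mathbf{X}))$, where $\mathcal{O}(\mathbf{X})$ represents an open set $U$ by its characteristic map $\chi_U\in\mathcal{C}(\mathbf{X},\mathbb{S})$ into Sierpiński space $\mathbb{S}=\{\bot,\top\}$ ($\delta_\mathbb{S}(0^\omega)=\bot$, else $\top$) with the standard function-space representation. *)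

theory Defs
  imports "HOL-Analysis.Analysis" "HOL-Library.Nat_Bijection" "HOL-Library.FuncSet"
begin

type_synonym cantor = "nat \<Rightarrow> bool"

text \<open>A representation of a set \<open>X\<close> is a partial surjection from Cantor space onto \<open>X\<close>: a partial
  map \<open>\<delta>\<close> with \<open>ran \<delta> = X\<close>. The set represented by \<open>\<delta>\<close> is thus always \<open>ran \<delta>\<close>.\<close>

type_synonym 'a rep = "cantor \<rightharpoonup> 'a"


section \<open>Computability on Cantor space\<close>

text \<open>Programs for partial recursive functions on the natural numbers with an oracle in Cantor
  space. In \<open>PrimRec f g\<close> and \<open>Mu f\<close>, the recursion or search variable is the first argument, and
  \<open>g\<close> receives the counter, the previous value, and the parameters.\<close>

datatype prog =
    Zero
  | Succ
  | Proj nat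
  | Query
  | Comp prog "prog list"
  | PrimRec prog prog
  | Mu prog

inductive eval :: "cantor \<Rightarrow> prog \<Rightarrow> nat list \<Rightarrow> nat \<Rightarrow> bool" for p :: cantor where
  eval_Zero: "eval p Zero xs 0"
| eval_Succ: "eval p Succ [x] (Suc x)"
| eval_Proj: "i < length xs \<Longrightarrow> eval p (Proj i) xs (xs ! i)"
| eval_Query: "eval p Query [x] (of_bool (p x))"
| eval_Comp: "list_all2 (\<lambda>g y. eval p g xs y) gs ys \<Longrightarrow> eval p f ys z \<Longrightarrow> eval p (Comp f gs) xs z"
| eval_PrimRec_0: "eval p f xs y \<Longrightarrow> eval p (PrimRec f g) (0 # xs) y"
| eval_PrimRec_Suc: "eval p (PrimRec f g) (n # xs) r \<Longrightarrow> eval p g (n # r # xs) y \<Longrightarrow>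
    eval p (PrimRec f g) (Suc n # xs) y"
| eval_Mu: "eval p f (n # xs) 0 \<Longrightarrow> (\<forall>i<n. \<exists>y. eval p f (i # xs) (Suc y)) \<Longrightarrow> eval p (Mu f) xs n"

lemma eval_deterministic: "eval p e xs y \<Longrightarrow> eval p e xs z \<Longrightarrow> y = z"
proof (induction arbitrary: z rule: eval.induct)
  case (eval_Comp xs gs ys f y)
  from eval_Comp.prems obtain zs where zs: "list_all2 (\<lambda>g y. eval p g xs y) gs zs" "eval p f zs z"
    by cases
  have "ys = zs"
    using eval_Comp.IH(1) zs(1)
    by (intro nth_equalityI) (auto simp: list_all2_conv_all_nth)
  then show ?case using eval_Comp.IH(2) zs(2) by blast
next
  case (eval_Mu f n xs)
  from eval_Mu.prems obtain
    z: "eval p f (z # xs) 0" "\<forall>i<z. \<exists>y. eval p f (i # xs) (Suc y)"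
    by cases
  have "\<not> n < z" using eval_Mu.IH(1) z(2) by (metis nat.distinct(1))
  moreover have "\<not> z < n" using eval_Mu.IH(2) z(1) by (metis nat.distinct(1))
  ultimately show ?case by simp
next
  case (eval_PrimRec_Suc f g n xs r y)
  from eval_PrimRec_Suc.prems obtain r'
    where "eval p (PrimRec f g) (n # xs) r'" "eval p g (n # r' # xs) z"
    by cases
  then show ?case using eval_PrimRec_Suc.IH by blast
next
  case (eval_PrimRec_0 f xs y g)
  from eval_PrimRec_0.prems have "eval p f xs z" by cases
  then show ?case using eval_PrimRec_0.IH by blast
next
  case (eval_Zero xs)
  then show ?case by cases simp
next
  case (eval_Succ x)
  then show ?case by cases simp
next
  case (eval_Proj i xs)
  from eval_Proj.prems show ?case by cases simp
next
  case (eval_Query x)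
  then show ?case by cases simp
qed

text \<open>A partial function on Cantor space is computable if one oracle program computes, for every
  \<open>p\<close> in its domain given as oracle, the digits of the value at \<open>p\<close>. As usual, the behaviour of the
  program outside the domain is irrelevant.\<close>

definition computable :: "(cantor \<rightharpoonup> cantor) \<Rightarrow> bool" where
  "computable F \<longleftrightarrow> (\<exists>e. \<forall>p q. F p = Some q \<longrightarrow> (\<forall>n. eval p e [n] (of_bool (q n))))"

definition realizes :: "(cantor \<rightharpoonup> cantor) \<Rightarrow> 'a rep \<Rightarrow> 'b rep \<Rightarrow> ('a \<Rightarrow> 'b) \<Rightarrow> bool" where
  "realizes F \<delta>X \<delta>Y f \<longleftrightarrow> (\<forall>p x. \<delta>X p = Some x \<longrightarrow> (\<exists>q. F p = Some q \<and> \<delta>Y q = Some (f x)))"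

definition computable_map :: "'a rep \<Rightarrow> 'b rep \<Rightarrow> ('a \<Rightarrow> 'b) \<Rightarrow> bool" where
  "computable_map \<delta>X \<delta>Y f \<longleftrightarrow> (\<exists>F. computable F \<and> realizes F \<delta>X \<delta>Y f)"

definition computably_equivalent :: "'a rep \<Rightarrow> 'a rep \<Rightarrow> bool" where
  "computably_equivalent \<delta> \<delta>' \<longleftrightarrow> computable_map \<delta> \<delta>' id \<and> computable_map \<delta>' \<delta> id"

definition cantor_rep :: "cantor rep" where
  "cantor_rep p = Some p"


section \<open>Function spaces, open sets and compact sets\<close>

text \<open>Bijective binary coding of finite words.\<close>

fun word_code :: "bool list \<Rightarrow> nat" where
  "word_code [] = 0"
| "word_code (b # u) = 2 * word_code u + (if b then 2 else 1)"

definition prefix_word :: "cantor \<Rightarrow> nat \<Rightarrow> bool list" where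
  "prefix_word q k = map q [0..<k]"

definition info_code :: "nat \<Rightarrow> bool \<Rightarrow> bool list \<Rightarrow> nat" where
  "info_code n b u = prod_encode (n, prod_encode (of_bool b, word_code u))"

text \<open>The standard numbering of partial continuous functions on Cantor space by Kleene associates:
  \<open>p\<close> is read as a set of pieces of information \<open>(n, b, u)\<close>, each saying that digit \<open>n\<close> of the output
  is \<open>b\<close> whenever the input begins with the word \<open>u\<close>. The value at \<open>q\<close> is defined if the prefixes of
  \<open>q\<close> determine every output digit without conflict.\<close>

definition says :: "cantor \<Rightarrow> cantor \<Rightarrow> nat \<Rightarrow> bool \<Rightarrow> bool" where
  "says p q n b \<longleftrightarrow> (\<exists>k. p (info_code n b (prefix_word q k)))"

definition associate_fun :: "cantor \<Rightarrow> cantor \<rightharpoonup> cantor" where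
  "associate_fun p q =
     (if \<forall>n. \<exists>!b. says p q n b then Some (\<lambda>n. THE b. says p q n b) else None)"

text \<open>The space \<open>C(X, Y)\<close>. Its elements are functions on \<open>ran \<delta>X\<close>, kept extensional so that a name
  determines at most one of them.\<close>

definition fun_rep :: "'a rep \<Rightarrow> 'b rep \<Rightarrow> ('a \<Rightarrow> 'b) rep" where
  "fun_rep \<delta>X \<delta>Y p =
     (if \<exists>f \<in> extensional (ran \<delta>X). realizes (associate_fun p) \<delta>X \<delta>Y f
      then Some (THE f. f \<in> extensional (ran \<delta>X) \<and> realizes (associate_fun p) \<delta>X \<delta>Y f)
      else None)"

text \<open>Sierpinski space, with \<open>True\<close> for top and \<open>False\<close> for bottom.\<close>

definition sierpinski_rep :: "bool rep" where
  "sierpinski_rep p = Some (\<exists>n. p n)"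

definition open_rep :: "'a rep \<Rightarrow> 'a set rep" where
  "open_rep \<delta>X p = map_option (\<lambda>f. {x \<in> ran \<delta>X. f x}) (fun_rep \<delta>X sierpinski_rep p)"

text \<open>A compact set is determined by its open neighbourhoods since Cantor space is Hausdorff.\<close>

definition compact_rep :: "cantor set rep" where
  "compact_rep p =
     (let names = (\<lambda>A. compact A \<and>
            open_rep (open_rep cantor_rep) p = Some {U \<in> ran (open_rep cantor_rep). A \<subseteq> U})
      in if \<exists>A. names A then Some (THE A. names A) else None)"


section \<open>Plotkin's T and its sequences\<close>

text \<open>\<open>None\<close> is bottom, \<open>Some False\<close> is 0 and \<open>Some True\<close> is 1.\<close>

type_synonym plotkin = "bool option"
type_synonym plotkin_seq = "nat \<Rightarrow> plotkin"

definition plotkin_rep :: "cantor \<Rightarrow> plotkin" where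
  "plotkin_rep p = (if \<forall>n. \<not> p n then None else Some (odd (LEAST n. p n)))"

definition plotkin_seq_rep :: "cantor \<Rightarrow> plotkin_seq" where
  "plotkin_seq_rep p n = plotkin_rep (\<lambda>k. p (prod_encode (n, k)))"

definition plotkin_le :: "plotkin_seq \<Rightarrow> plotkin_seq \<Rightarrow> bool" (infix \<open>\<preceq>\<close> 50) where
  "p \<preceq> q \<longleftrightarrow> (\<forall>n. p n \<noteq> None \<longrightarrow> p n = q n)"

definition plotkin_of_cantor :: "cantor \<Rightarrow> plotkin_seq" where
  "plotkin_of_cantor q n = Some (q n)"

end

theory Submission
  imports Defs
begin

text \<open>
  Fix a numbering \<open>C\<^sub>0, C\<^sub>1, \<dots>\<close> of clopen sets comprising the complements of all cylinders and the
  sets \<open>{x. x n = 1}\<close>. The \<open>\<delta>\<close>-name of \<open>x\<close> is the sequence of truth values of \<open>x \<in> C\<^sub>i\<close>, and \<open>\<psi> p\<close> is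
  the set of all \<open>x\<close> whose name extends \<open>p\<close>. Then \<open>\<psi>\<close> is total, every value is closed and hence
  compact, and the matching property is immediate.

  From a standard name of \<open>A\<close> one semidecides \<open>A \<subseteq> C\<^sub>i\<close>. Setting \<open>p i = 1\<close> if this holds and \<open>p i = \<bottom>\<close>
  otherwise gives \<open>\<psi> p = A\<close>, as a closed set is the intersection of the \<open>C\<^sub>i\<close> above it. Conversely, given
  \<open>p\<close> and a name of \<open>U\<close>, the points seen by stage \<open>n\<close> to lie outside \<open>\<psi> p\<close> or inside \<open>U\<close> form an
  increasing sequence of clopen sets, so by compactness \<open>\<psi> p \<subseteq> U\<close> iff one of them is the whole space.
\<close>

section \<open>Total recursive functions with an oracle\<close>

text \<open>All translations between names constructed below are total maps, so halting is asked for
  every oracle and no domain has to be tracked.\<close>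

definition recursive :: "nat \<Rightarrow> (cantor \<Rightarrow> nat list \<Rightarrow> nat) \<Rightarrow> bool" where
  "recursive k f \<longleftrightarrow> (\<exists>e. \<forall>p xs. length xs = k \<longrightarrow> eval p e xs (f p xs))"

abbreviation decidable :: "nat \<Rightarrow> (cantor \<Rightarrow> nat list \<Rightarrow> bool) \<Rightarrow> bool" where
  "decidable k P \<equiv> recursive k (\<lambda>p xs. of_bool (P p xs))"

text \<open>The closure rules below represent the variables of a context by \<open>hd xs\<close>, \<open>hd (tl xs)\<close>, \<open>\<dots>\<close>, the
  innermost one first, which keeps their conclusions higher-order patterns.\<close>

named_theorems rec_intros

lemma recursiveI: "(\<And>p xs. length xs = k \<Longrightarrow> eval p e xs (f p xs)) \<Longrightarrow> recursive k f"
  unfolding recursive_def by blast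

lemma recursive_cong:
  "recursive k f \<Longrightarrow> (\<And>p xs. length xs = k \<Longrightarrow> f p xs = g p xs) \<Longrightarrow> recursive k g"
  unfolding recursive_def by metis

lemma recursive_nth: "j < k \<Longrightarrow> recursive k (\<lambda>p xs. xs ! j)"
  by (rule recursiveI[where e = "Proj j"]) (auto intro: eval_Proj)

lemma recursive_vars [rec_intros]:
  "recursive (Suc k) (\<lambda>p xs. hd xs)"
  "recursive (Suc (Suc k)) (\<lambda>p xs. hd (tl xs))"
  "recursive (Suc (Suc (Suc k))) (\<lambda>p xs. hd (tl (tl xs)))"
  "recursive (Suc (Suc (Suc (Suc k)))) (\<lambda>p xs. hd (tl (tl (tl xs))))"
  "recursive (Suc (Suc (Suc (Suc (Suc k))))) (\<lambda>p xs. hd (tl (tl (tl (tl xs)))))"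
  "recursive (Suc (Suc (Suc (Suc (Suc (Suc k)))))) (\<lambda>p xs. hd (tl (tl (tl (tl (tl xs))))))"
  by (rule recursive_cong[OF recursive_nth[of 0]], simp, force simp: length_Suc_conv,
      rule recursive_cong[OF recursive_nth[of 1]], simp, force simp: length_Suc_conv,
      rule recursive_cong[OF recursive_nth[of 2]], simp, force simp: length_Suc_conv,
      rule recursive_cong[OF recursive_nth[of 3]], simp, force simp: length_Suc_conv,
      rule recursive_cong[OF recursive_nth[of 4]], simp, force simp: length_Suc_conv,
      rule recursive_cong[OF recursive_nth[of 5]], simp, force simp: length_Suc_conv)

lemma recursive_comp1:
  assumes h: "recursive (Suc 0) (\<lambda>p ys. h p (hd ys))" and f: "recursive k f"
  shows "recursive k (\<lambda>p xs. h p (f p xs))"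
proof -
  obtain e where e: "\<And>p xs. length xs = Suc 0 \<Longrightarrow> eval p e xs (h p (hd xs))"
    using h unfolding recursive_def by blast
  obtain e1 where e1: "\<And>p xs. length xs = k \<Longrightarrow> eval p e1 xs (f p xs)"
    using f unfolding recursive_def by blast
  have "eval p (Comp e [e1]) xs (h p (f p xs))" if "length xs = k" for p xs
    using e[of "[f p xs]" p] e1[OF that] by (intro eval_Comp[where ys = "[f p xs]"]) auto
  then show ?thesis by (rule recursiveI)
qed

lemma recursive_comp2:
  assumes h: "recursive (Suc (Suc 0)) (\<lambda>p ys. h p (hd ys) (hd (tl ys)))"
    and f: "recursive k f" and g: "recursive k g"
  shows "recursive k (\<lambda>p xs. h p (f p xs) (g p xs))"
proof -
  obtain e where e: "\<And>p xs. length xs = Suc (Suc 0) \<Longrightarrow> eval p e xs (h p (hd xs) (hd (tl xs)))"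
    using h unfolding recursive_def by blast
  obtain e1 where e1: "\<And>p xs. length xs = k \<Longrightarrow> eval p e1 xs (f p xs)"
    using f unfolding recursive_def by blast
  obtain e2 where e2: "\<And>p xs. length xs = k \<Longrightarrow> eval p e2 xs (g p xs)"
    using g unfolding recursive_def by blast
  have "eval p (Comp e [e1, e2]) xs (h p (f p xs) (g p xs))" if "length xs = k" for p xs
    using e[of "[f p xs, g p xs]" p] e1[OF that] e2[OF that]
    by (intro eval_Comp[where ys = "[f p xs, g p xs]"]) auto
  then show ?thesis by (rule recursiveI)
qed

lemma recursive_Suc [rec_intros]: "recursive k f \<Longrightarrow> recursive k (\<lambda>p xs. Suc (f p xs))"
  by (rule recursive_comp1[where h = "\<lambda>_. Suc"])
    (auto intro!: recursiveI[where e = Succ] eval_Succ simp: length_Suc_conv)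

lemma recursive_const [rec_intros]: "recursive k (\<lambda>p xs. c)"
proof (induction c)
  case 0
  show ?case by (rule recursiveI[where e = Zero]) (rule eval_Zero)
qed (rule recursive_Suc)

lemma decidable_query [rec_intros]: "recursive k f \<Longrightarrow> decidable k (\<lambda>p xs. p (f p xs))"
  by (rule recursive_comp1[where h = "\<lambda>p x. of_bool (p x)"])
    (auto intro!: recursiveI[where e = Query] simp: length_Suc_conv eval_Query split del: split_of_bool)

lemma recursive_rec_nat:
  assumes f: "recursive k f"
    and g: "recursive (Suc (Suc k)) (\<lambda>p ys. g p (hd ys) (hd (tl ys)) (tl (tl ys)))"
    and b: "recursive k b"
  shows "recursive k (\<lambda>p xs. rec_nat (f p xs) (\<lambda>n r. g p n r xs) (b p xs))"
proof -
  obtain ef where ef: "\<And>p xs. length xs = k \<Longrightarrow> eval p ef xs (f p xs)"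
    using f unfolding recursive_def by blast
  obtain eg where eg: "\<And>p xs. length xs = Suc (Suc k) \<Longrightarrow>
      eval p eg xs (g p (hd xs) (hd (tl xs)) (tl (tl xs)))"
    using g unfolding recursive_def by blast
  obtain eb where eb: "\<And>p xs. length xs = k \<Longrightarrow> eval p eb xs (b p xs)"
    using b unfolding recursive_def by blast
  have rec: "eval p (PrimRec ef eg) (n # xs) (rec_nat (f p xs) (\<lambda>n r. g p n r xs) n)"
    if "length xs = k" for p xs n
  proof (induction n)
    case 0
    show ?case using ef[OF that] by (auto intro: eval_PrimRec_0)
  next
    case (Suc n)
    show ?case
      using eg[of "n # rec_nat (f p xs) (\<lambda>n r. g p n r xs) n # xs" p] that
      by (auto intro: eval_PrimRec_Suc[OF Suc])
  qed
  \<comment> \<open>\<open>PrimRec\<close> recurses on the head of its argument list, so the bound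
    is computed first and the parameters are copied behind it by projections.\<close>
  have "eval p (Comp (PrimRec ef eg) (eb # map Proj [0..<k])) xs
      (rec_nat (f p xs) (\<lambda>n r. g p n r xs) (b p xs))" if "length xs = k" for p xs
    using eb[OF that] rec[OF that] that
    by (intro eval_Comp[where ys = "b p xs # xs"])
      (auto simp: list_all2_conv_all_nth nth_Cons' intro: eval_Proj)
  then show ?thesis by (rule recursiveI)
qed

section \<open>Arithmetic by primitive recursion\<close>

lemma recursive_add [rec_intros]:
  assumes "recursive k f" "recursive k g"
  shows "recursive k (\<lambda>p xs. f p xs + g p xs)"
proof -
  have "rec_nat x (\<lambda>_ r. Suc r) y = x + y" for x y by (induction y) auto
  moreover have "recursive k (\<lambda>p xs. rec_nat (f p xs) (\<lambda>_ r. Suc r) (g p xs))"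
    by (intro recursive_rec_nat rec_intros assms)
  ultimately show ?thesis by simp
qed

lemma recursive_mult [rec_intros]:
  assumes "recursive k f" "recursive k g"
  shows "recursive k (\<lambda>p xs. f p xs * g p xs)"
proof (rule recursive_comp2[OF _ assms])
  have "rec_nat 0 (\<lambda>_ r. x + r) y = x * y" for x y :: nat by (induction y) auto
  moreover have "recursive (Suc (Suc 0)) (\<lambda>p ys. rec_nat 0 (\<lambda>_ r. hd ys + r) (hd (tl ys)))"
    by (intro recursive_rec_nat rec_intros)
  ultimately show "recursive (Suc (Suc 0)) (\<lambda>p ys. hd ys * hd (tl ys))" by simp
qed

lemma recursive_power [rec_intros]:
  assumes "recursive k f" "recursive k g"
  shows "recursive k (\<lambda>p xs. f p xs ^ g p xs)"
proof (rule recursive_comp2[OF _ assms])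
  have "rec_nat 1 (\<lambda>_ r. x * r) y = x ^ y" for x y :: nat by (induction y) auto
  moreover have "recursive (Suc (Suc 0)) (\<lambda>p ys. rec_nat 1 (\<lambda>_ r. hd ys * r) (hd (tl ys)))"
    by (intro recursive_rec_nat rec_intros)
  ultimately show "recursive (Suc (Suc 0)) (\<lambda>p ys. hd ys ^ hd (tl ys))" by simp
qed

lemma recursive_diff [rec_intros]:
  assumes "recursive k f" "recursive k g"
  shows "recursive k (\<lambda>p xs. f p xs - g p xs)"
proof -
  \<comment> \<open>The predecessor is the recursion that returns its counter; iterating it gives
    truncated subtraction.\<close>
  have "rec_nat 0 (\<lambda>n _. n) y = y - Suc 0" for y :: nat by (induction y) auto
  moreover have "recursive j (\<lambda>p xs. rec_nat 0 (\<lambda>n _. n) (h p xs))" if "recursive j h" for j h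
    by (intro recursive_rec_nat rec_intros that)
  ultimately have pred: "recursive j h \<Longrightarrow> recursive j (\<lambda>p xs. h p xs - Suc 0)" for j h
    by simp
  have "rec_nat x (\<lambda>_ r. r - Suc 0) y = x - y" for x y :: nat by (induction y) auto
  moreover have "recursive k (\<lambda>p xs. rec_nat (f p xs) (\<lambda>_ r. r - Suc 0) (g p xs))"
    by (intro recursive_rec_nat rec_intros pred assms)
  ultimately show ?thesis by simp
qed

lemma recursive_sum [rec_intros]:
  assumes "recursive (Suc k) (\<lambda>p ys. f p (hd ys) (tl ys))" "recursive k b"
  shows "recursive k (\<lambda>p xs. \<Sum>i<b p xs. f p i xs)"
proof -
  obtain e where e: "\<And>p xs. length xs = Suc k \<Longrightarrow> eval p e xs (f p (hd xs) (tl xs))"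
    using assms(1) unfolding recursive_def by blast
  \<comment> \<open>The step function of the recursion receives the running total as its second
    argument; the projections skip it before \<open>f\<close> is called.\<close>
  have "recursive (Suc (Suc k)) (\<lambda>p ys. f p (hd ys) (tl (tl ys)))"
  proof (rule recursiveI)
    fix p :: cantor and xs :: "nat list"
    assume len: "length xs = Suc (Suc k)"
    then obtain n r zs where xs: "xs = n # r # zs" "length zs = k"
      by (auto simp: length_Suc_conv)
    show "eval p (Comp e (Proj 0 # map (\<lambda>i. Proj (Suc (Suc i))) [0..<k])) xs
        (f p (hd xs) (tl (tl xs)))"
      using e[of "n # zs" p] xs eval_Proj[of 0 xs p] eval_Proj[of "Suc (Suc _)" xs p]
      by (intro eval_Comp[where ys = "n # zs"]) (auto simp: list_all2_conv_all_nth nth_Cons split: nat.splits)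
  qed
  then have g: "recursive (Suc (Suc k)) (\<lambda>p ys. hd (tl ys) + f p (hd ys) (tl (tl ys)))"
    by (intro rec_intros)
  have "rec_nat 0 (\<lambda>n r. r + h n) y = (\<Sum>i<y. h i)" for y and h :: "nat \<Rightarrow> nat"
    by (induction y) auto
  then show ?thesis
    using recursive_rec_nat[where g = "\<lambda>p n r xs. r + f p n xs", OF recursive_const[of k 0] g assms(2)]
    by simp
qed

section \<open>Decidable predicates and bounded quantifiers\<close>

lemma decidable_le [rec_intros]:
  assumes "recursive k f" "recursive k g"
  shows "decidable k (\<lambda>p xs. f p xs \<le> g p xs)"
proof -
  have "recursive k (\<lambda>p xs. 1 - (f p xs - g p xs))" by (intro rec_intros assms)
  then show ?thesis by (rule recursive_cong) auto
qed

lemma decidable_less [rec_intros]: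
  assumes "recursive k f" "recursive k g"
  shows "decidable k (\<lambda>p xs. f p xs < g p xs)"
  using decidable_le[OF recursive_Suc[OF assms(1)] assms(2)] by (simp add: Suc_le_eq)

lemma decidable_not [rec_intros]:
  assumes "decidable k P"
  shows "decidable k (\<lambda>p xs. \<not> P p xs)"
proof -
  have "recursive k (\<lambda>p xs. 1 - of_bool (P p xs))" by (intro rec_intros assms)
  then show ?thesis by (rule recursive_cong) auto
qed

lemma decidable_conj [rec_intros]:
  assumes "decidable k P" "decidable k Q"
  shows "decidable k (\<lambda>p xs. P p xs \<and> Q p xs)"
  using recursive_mult[OF assms] by (simp add: of_bool_conj)

lemma decidable_disj [rec_intros]:
  assumes "decidable k P" "decidable k Q"
  shows "decidable k (\<lambda>p xs. P p xs \<or> Q p xs)"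
  using decidable_not[OF decidable_conj[OF assms[THEN decidable_not]]] by simp

lemma decidable_iff [rec_intros]:
  assumes "decidable k P" "decidable k Q"
  shows "decidable k (\<lambda>p xs. P p xs \<longleftrightarrow> Q p xs)"
proof -
  have "decidable k (\<lambda>p xs. P p xs \<and> Q p xs \<or> \<not> P p xs \<and> \<not> Q p xs)"
    by (intro rec_intros assms)
  then show ?thesis by (rule recursive_cong) auto
qed

lemma decidable_eq [rec_intros]:
  assumes "recursive k f" "recursive k g"
  shows "decidable k (\<lambda>p xs. f p xs = g p xs)"
proof -
  have "decidable k (\<lambda>p xs. f p xs \<le> g p xs \<and> g p xs \<le> f p xs)" by (intro rec_intros assms)
  then show ?thesis by (rule recursive_cong) auto
qed

lemma decidable_bex [rec_intros]:
  assumes "decidable (Suc k) (\<lambda>p ys. P p (hd ys) (tl ys))" "recursive k b"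
  shows "decidable k (\<lambda>p xs. \<exists>i<b p xs. P p i xs)"
proof -
  have "decidable k (\<lambda>p xs. 1 \<le> (\<Sum>i<b p xs. of_bool (P p i xs) :: nat))"
    by (intro rec_intros assms)
  then show ?thesis
    by (rule recursive_cong) (auto simp: Suc_le_eq sum_eq_0_iff simp flip: neq0_conv)
qed

lemma decidable_ball [rec_intros]:
  assumes "decidable (Suc k) (\<lambda>p ys. P p (hd ys) (tl ys))" "recursive k b"
  shows "decidable k (\<lambda>p xs. \<forall>i<b p xs. P p i xs)"
  using decidable_not[OF decidable_bex[OF decidable_not[OF assms(1)] assms(2)]]
  by simp

section \<open>Unbounded search, with division and unpairing as instances\<close>

lemma recursive_Least:
  assumes P: "decidable (Suc k) (\<lambda>p ys. P p (hd ys) (tl ys))"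
    and ex: "\<And>p xs. \<exists>n. P p n xs"
  shows "recursive k (\<lambda>p xs. LEAST n. P p n xs)"
proof -
  \<comment> \<open>\<open>Mu\<close> searches for a zero, so the program decides the negation of
    \<open>P\<close>; \<open>ex\<close> makes the search end.\<close>
  obtain e where e: "\<And>p xs. length xs = Suc k \<Longrightarrow> eval p e xs (of_bool (\<not> P p (hd xs) (tl xs)))"
    using decidable_not[OF P] unfolding recursive_def by blast
  show ?thesis
  proof (rule recursiveI)
    fix p :: cantor and xs :: "nat list"
    assume len: "length xs = k"
    have e': "eval p e (n # xs) (of_bool (\<not> P p n xs))" for n using e[of "n # xs" p] len by simp
    have "P p (LEAST n. P p n xs) xs" using ex by (rule LeastI_ex)
    moreover have "\<not> P p i xs" if "i < (LEAST n. P p n xs)" for i using that by (rule not_less_Least)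
    ultimately show "eval p (Mu e) xs (LEAST n. P p n xs)"
      using e' by (intro eval_Mu) (metis of_bool_eq(1), metis One_nat_def of_bool_eq(2))
  qed
qed

lemma recursive_div [rec_intros]:
  assumes "recursive k f" "recursive k g"
  shows "recursive k (\<lambda>p xs. f p xs div g p xs)"
proof (rule recursive_comp2[OF _ assms])
  \<comment> \<open>For divisor zero the disjunct \<open>n = 0\<close> stops the search at once, in
    accordance with \<open>m div 0 = 0\<close>.\<close>
  have ex: "n = 0 \<or> m < n * Suc (m div n)" for m n :: nat
    using dividend_less_times_div[of n m] by auto
  have "(LEAST q. n = 0 \<or> m < n * Suc q) = m div n" for m n :: nat
  proof (rule Least_equality)
    show "n = 0 \<or> m < n * Suc (m div n)" by (rule ex)
    fix q assume "n = 0 \<or> m < n * Suc q"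
    then show "m div n \<le> q"
      by (metis div_by_0 less_Suc_eq_le less_mult_imp_div_less mult.commute zero_le)
  qed
  moreover have "recursive (Suc (Suc 0))
      (\<lambda>p ys. LEAST q. hd (tl ys) = 0 \<or> hd ys < hd (tl ys) * Suc q)"
    by (rule recursive_Least) (intro rec_intros, use ex in blast)
  ultimately show "recursive (Suc (Suc 0)) (\<lambda>p ys. hd ys div hd (tl ys))" by simp
qed

lemma decidable_odd [rec_intros]:
  assumes "recursive k f"
  shows "decidable k (\<lambda>p xs. odd (f p xs))"
proof -
  have "odd m \<longleftrightarrow> \<not> m = 2 * (m div 2)" for m :: nat by presburger
  then show ?thesis by (simp only:) (intro rec_intros assms)
qed

lemma decidable_bit [rec_intros]:
  assumes "recursive k f" "recursive k g"
  shows "decidable k (\<lambda>p xs. bit (f p xs) (g p xs))"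
  unfolding bit_iff_odd by (intro rec_intros assms)

lemma recursive_prod_encode [rec_intros]:
  assumes "recursive k f" "recursive k g"
  shows "recursive k (\<lambda>p xs. prod_encode (f p xs, g p xs))"
  unfolding prod_encode_def triangle_def by (simp, intro rec_intros assms)

text \<open>Both components are bounded by the code, so each is found by a search whose test
  quantifies boundedly over the other.\<close>

lemma recursive_prod_decode [rec_intros]:
  assumes "recursive k f"
  shows "recursive k (\<lambda>p xs. fst (prod_decode (f p xs)))"
    and "recursive k (\<lambda>p xs. snd (prod_decode (f p xs)))"
proof -
  have decode: "prod_encode (i, j) = m \<longleftrightarrow> prod_decode m = (i, j)" for i j m
    by (metis prod_decode_inverse prod_encode_inverse)
  have le: "fst (prod_decode m) < Suc m" "snd (prod_decode m) < Suc m" for m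
    using le_prod_encode_1 le_prod_encode_2 prod_decode_inverse
    by (metis less_Suc_eq_le prod.collapse)+
  have fst: "(\<exists>j<Suc m. prod_encode (i, j) = m) \<longleftrightarrow> i = fst (prod_decode m)" for i m
    using le(2)[of m] by (cases "prod_decode m") (auto simp: decode)
  have snd: "(\<exists>j<Suc m. prod_encode (j, i) = m) \<longleftrightarrow> i = snd (prod_decode m)" for i m
    using le(1)[of m] by (cases "prod_decode m") (auto simp: decode)
  have "recursive (Suc 0) (\<lambda>p xs. LEAST i. \<exists>j<Suc (hd xs). prod_encode (i, j) = hd xs)"
    by (rule recursive_Least) (intro rec_intros, simp add: fst)
  then have "recursive (Suc 0) (\<lambda>p xs. fst (prod_decode (hd xs)))"
    by (simp add: fst Least_equality)
  from recursive_comp1[OF this assms] show "recursive k (\<lambda>p xs. fst (prod_decode (f p xs)))" .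
  have "recursive (Suc 0) (\<lambda>p xs. LEAST i. \<exists>j<Suc (hd xs). prod_encode (j, i) = hd xs)"
    by (rule recursive_Least) (intro rec_intros, simp add: snd)
  then have "recursive (Suc 0) (\<lambda>p xs. snd (prod_decode (hd xs)))"
    by (simp add: snd Least_equality)
  from recursive_comp1[OF this assms] show "recursive k (\<lambda>p xs. snd (prod_decode (f p xs)))" .
qed

lemma computable_if_decidable:
  assumes "decidable (Suc 0) (\<lambda>p ys. G p (hd ys))"
  shows "computable (\<lambda>p. Some (G p))"
proof -
  obtain e where "\<And>p xs. length xs = Suc 0 \<Longrightarrow> eval p e xs (of_bool (G p (hd xs)))"
    using assms unfolding recursive_def by blast
  then have "eval p e [n] (of_bool (G p n))" for p n by (metis length_Cons list.sel(1) list.size(3))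
  then show ?thesis unfolding computable_def by blast
qed

section \<open>Words\<close>

text \<open>After adding one, the bijective code becomes an ordinary binary number, lowest digit
  first: the word followed by a leading 1.\<close>

lemma word_code_horner: "Suc (word_code u) = horner_sum of_bool 2 (u @ [True])"
  by (induction u) auto

lemma word_code_prefix: "Suc (word_code (prefix_word x n)) = (\<Sum>i<n. of_bool (x i) * 2 ^ i) + 2 ^ n"
  by (simp add: word_code_horner horner_sum_append horner_sum_eq_sum prefix_word_def
      nth_append flip: lessThan_atLeast0 del: sum_of_bool_mult_eq)

lemma recursive_word_code_prefix [rec_intros]:
  assumes "decidable (Suc k) (\<lambda>p ys. X p (hd ys) (tl ys))" "recursive k n"
  shows "recursive k (\<lambda>p xs. word_code (prefix_word (\<lambda>j. X p j xs) (n p xs)))"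
proof -
  have "recursive k (\<lambda>p xs. (\<Sum>i<n p xs. of_bool (X p i xs) * 2 ^ i) + 2 ^ n p xs - 1)"
    by (intro rec_intros assms)
  then show ?thesis
    by (rule recursive_cong) (simp flip: word_code_prefix del: sum_of_bool_mult_eq)
qed

lemma bit_word_code: "i < length u \<Longrightarrow> bit (Suc (word_code u)) i = u ! i"
  unfolding word_code_horner by (simp add: bit_horner_sum_bit_iff nth_append)

text \<open>The appended 1 is the highest digit, so the bit length of the number reveals the length
  of the word.\<close>

lemma word_code_length:
  "2 ^ n \<le> Suc (word_code u) \<and> Suc (word_code u) < 2 ^ Suc n \<longleftrightarrow> length u = n"
proof -
  have lo: "2 ^ length u \<le> Suc (word_code u)" and hi: "Suc (word_code u) < 2 ^ Suc (length u)"
    by (induction u) auto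
  have "m \<le> n \<Longrightarrow> (2::nat) ^ m \<le> 2 ^ n" for m n :: nat by (rule power_increasing) auto
  then show ?thesis using lo hi
    by (metis Suc_le_eq le_antisym leD not_less_eq_eq order.strict_trans2)
qed

lemma prefix_word_eq_iff: "prefix_word x n = prefix_word y n \<longleftrightarrow> (\<forall>i<n. x i = y i)"
  by (auto simp: prefix_word_def)

lemma word_code_inj: "word_code u = word_code v \<longleftrightarrow> u = v"
proof
  assume eq: "word_code u = word_code v"
  then have "length u = length v" by (metis word_code_length)
  then show "u = v" using eq by (auto intro: nth_equalityI simp flip: bit_word_code)
qed simp

lemma ex_nat_bits: "\<exists>a<2 ^ n. \<forall>i<n. bit (a::nat) i = x i"
  using horner_sum_of_bool_2_less[of "map x [0..<n]"]
  by (intro exI[of _ "horner_sum of_bool 2 (map x [0..<n])"]) (auto simp: bit_horner_sum_bit_iff)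

section \<open>Topology of Cantor space\<close>

text \<open>A clopen predicate with an explicit modulus; the modulus is the word length at which
  \<open>tabulate\<close> lists the values.\<close>

definition depends_below :: "nat \<Rightarrow> (cantor \<Rightarrow> bool) \<Rightarrow> bool" where
  "depends_below n P \<longleftrightarrow> (\<forall>x y. (\<forall>i<n. x i = y i) \<longrightarrow> P x = P y)"

lemma depends_belowD: "depends_below n P \<Longrightarrow> (\<And>i. i < n \<Longrightarrow> x i = y i) \<Longrightarrow> P x = P y"
  unfolding depends_below_def by blast

lemma depends_belowI: "(\<And>x y. (\<And>i. i < n \<Longrightarrow> x i = y i) \<Longrightarrow> P x = P y) \<Longrightarrow> depends_below n P"
  unfolding depends_below_def by blast

lemma open_cylinder: "open {y :: cantor. \<forall>i<n. y i = x i}"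
proof -
  have "open {y :: cantor. y i = x i}" for i
  proof -
    have "open ((\<lambda>y :: cantor. y i) -` {x i})"
      by (intro open_vimage continuous_on_product_coordinates open_discrete)
    then show ?thesis by (simp add: vimage_def)
  qed
  then have "open (\<Inter>i\<in>{..<n}. {y :: cantor. y i = x i})" by auto
  moreover have "(\<Inter>i\<in>{..<n}. {y :: cantor. y i = x i}) = {y. \<forall>i<n. y i = x i}" by auto
  ultimately show ?thesis by simp
qed

lemma depends_below_open:
  assumes "depends_below n P"
  shows "open {x. P x}"
proof (subst open_subopen, safe)
  fix x assume "P x"
  then have "{y. \<forall>i<n. y i = x i} \<subseteq> {x. P x}"
    using assms unfolding depends_below_def by blast
  then show "\<exists>T. open T \<and> x \<in> T \<and> T \<subseteq> {x. P x}"
    by (intro exI[of _ "{y. \<forall>i<n. y i = x i}"]) (simp add: open_cylinder)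
qed

lemma depends_below_closed:
  assumes "depends_below n P"
  shows "closed {x. P x}"
proof -
  have "depends_below n (\<lambda>x. \<not> P x)" using assms unfolding depends_below_def by blast
  then have "open {x. \<not> P x}" by (rule depends_below_open)
  then show ?thesis by (simp add: closed_def Collect_neg_eq)
qed

text \<open>A basic open set of the product restricts finitely many coordinates, and all of them lie
  below some \<open>n\<close>.\<close>

lemma open_cantor_contains_cylinder:
  fixes U :: "cantor set"
  assumes "open U" "x \<in> U"
  shows "\<exists>n. \<forall>y. (\<forall>i<n. y i = x i) \<longrightarrow> y \<in> U"
proof -
  have "openin (product_topology (\<lambda>_. euclidean) UNIV) U"
    using assms(1) by (simp add: open_fun_def)
  from product_topology_open_contains_basis[OF this assms(2)] obtain X where
    X: "x \<in> (\<Pi>\<^sub>E i\<in>UNIV. X i)" "finite {i. X i \<noteq> UNIV}" "(\<Pi>\<^sub>E i\<in>UNIV. X i) \<subseteq> U"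
    by auto
  obtain n where n: "\<And>i. X i \<noteq> UNIV \<Longrightarrow> i < n"
    using X(2) finite_nat_set_iff_bounded[of "{i. X i \<noteq> UNIV}"] by auto
  have "y \<in> U" if "\<forall>i<n. y i = x i" for y
  proof -
    have "y i \<in> X i" for i
      using X(1) n[of i] that by (cases "X i = UNIV") (auto simp: PiE_iff)
    then show ?thesis using X(3) by (auto simp: PiE_iff)
  qed
  then show ?thesis by blast
qed

lemma compact_cantor: "compact (UNIV :: cantor set)"
proof -
  have "compact (UNIV :: bool set)" by (simp add: finite_imp_compact)
  then have "compact_space (euclidean :: bool topology)"
    by (simp add: compact_space_def)
  then have "compact_space (product_topology (\<lambda>_ :: nat. euclidean :: bool topology) UNIV)"
    by (simp add: compact_space_product_topology)
  then have "compact_space (euclidean :: cantor topology)"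
    by (simp only: euclidean_product_topology)
  then show ?thesis by (simp add: compact_space_def)
qed

text \<open>Distinct points are separated by cylinders just long enough to reach a coordinate where
  they differ.\<close>

lemma Hausdorff_cantor: "Hausdorff_space (euclidean :: cantor topology)"
  unfolding Hausdorff_space_def
proof (intro allI impI, elim conjE)
  fix x y :: cantor assume "x \<noteq> y"
  then obtain i where i: "x i \<noteq> y i" by blast
  have "open {z :: cantor. \<forall>j<Suc i. z j = x j}" "open {z :: cantor. \<forall>j<Suc i. z j = y j}"
    by (rule open_cylinder)+
  moreover have "disjnt {z. \<forall>j<Suc i. z j = x j} {z. \<forall>j<Suc i. z j = y j}"
    using i by (auto simp: disjnt_iff)
  ultimately show "\<exists>U V. openin euclidean U \<and> openin euclidean V \<and> x \<in> U \<and> y \<in> V \<and> disjnt U V"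
    unfolding open_openin[symmetric] by blast
qed

lemma compact_cantor_iff_closed: "compact (A :: cantor set) \<longleftrightarrow> closed A"
proof
  assume "closed A"
  then show "compact A" using closed_Int_compact[OF _ compact_cantor, of A] by simp
next
  assume "compact A"
  then show "closed A" using compactin_imp_closedin[OF Hausdorff_cantor, of A] by simp
qed

section \<open>Names of open and compact sets\<close>

text \<open>A realizer fixes the value at every represented point and extensionality fixes the rest,
  so the description in \<open>fun_rep\<close> is unique.\<close>

lemma fun_rep_eq_Some:
  "fun_rep \<delta>X \<delta>Y p = Some f \<longleftrightarrow>
    f \<in> extensional (ran \<delta>X) \<and> realizes (associate_fun p) \<delta>X \<delta>Y f"
proof -
  have unique: "f = g" if "f \<in> extensional (ran \<delta>X)" "realizes (associate_fun p) \<delta>X \<delta>Y f"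
    "g \<in> extensional (ran \<delta>X)" "realizes (associate_fun p) \<delta>X \<delta>Y g" for f g
  proof (rule extensionalityI[OF that(1,3)])
    fix x assume "x \<in> ran \<delta>X"
    then obtain r where "\<delta>X r = Some x" by (auto simp: ran_def)
    then show "f x = g x" using that(2,4) unfolding realizes_def by fastforce
  qed
  let ?P = "\<lambda>f. f \<in> extensional (ran \<delta>X) \<and> realizes (associate_fun p) \<delta>X \<delta>Y f"
  have the: "(THE f. ?P f) = f" if "?P f" for f using that unique by blast
  show ?thesis unfolding fun_rep_def using the by auto
qed

text \<open>Eliminates the function space. This form serves both levels of
  \<open>compact_rep\<close>, open sets of points and open sets of open sets.\<close>

lemma open_rep_eq_Some:
  "open_rep \<delta>X p = Some U \<longleftrightarrow> U \<subseteq> ran \<delta>X \<and>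
     (\<forall>r x. \<delta>X r = Some x \<longrightarrow> (\<exists>s. associate_fun p r = Some s \<and> (\<exists>n. s n) = (x \<in> U)))"
  (is "_ \<longleftrightarrow> ?R")
proof
  assume "open_rep \<delta>X p = Some U"
  then obtain f where f: "fun_rep \<delta>X sierpinski_rep p = Some f" "U = {x \<in> ran \<delta>X. f x}"
    unfolding open_rep_def by auto
  have "realizes (associate_fun p) \<delta>X sierpinski_rep f"
    using f(1) by (simp add: fun_rep_eq_Some sierpinski_rep_def)
  then show ?R using f(2) unfolding realizes_def sierpinski_rep_def
    by (fastforce simp: ran_def)
next
  assume R: ?R
  let ?f = "restrict (\<lambda>x. x \<in> U) (ran \<delta>X)"
  have "realizes (associate_fun p) \<delta>X sierpinski_rep ?f"
    using R unfolding realizes_def sierpinski_rep_def by (fastforce simp: ran_def)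
  then have "fun_rep \<delta>X sierpinski_rep p = Some ?f"
    by (simp add: fun_rep_eq_Some sierpinski_rep_def)
  moreover have "{x \<in> ran \<delta>X. ?f x} = U" using R by auto
  ultimately show "open_rep \<delta>X p = Some U" unfolding open_rep_def by simp
qed

lemma associate_fun_eq_Some_says:
  assumes "associate_fun p q = Some s"
  shows "says p q n b \<longleftrightarrow> s n = b"
proof -
  have ex1: "\<exists>!b. says p q n b" and s: "s n = (THE b. says p q n b)"
    using assms unfolding associate_fun_def by (auto split: if_splits)
  from theI'[OF ex1] ex1 show ?thesis unfolding s by blast
qed

text \<open>Turns membership in \<open>U\<close> into a search for one positive piece of
  information, the search carried out by \<open>covered\<close>.\<close>

lemma open_rep_cantor_says:
  assumes "open_rep cantor_rep r = Some U"
  shows "x \<in> U \<longleftrightarrow> (\<exists>n. says r x n True)"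
proof -
  obtain s where "associate_fun r x = Some s" "(\<exists>n. s n) = (x \<in> U)"
    using assms unfolding open_rep_eq_Some cantor_rep_def by blast
  then show ?thesis by (auto simp: associate_fun_eq_Some_says)
qed

text \<open>Lists the value \<open>D n x\<close> against the words of length \<open>l n\<close>. The test on \<open>c\<close> says that \<open>c\<close> codes
  such a word, and the binary digits of \<open>Suc c\<close> extend that word.\<close>

definition tabulate :: "(nat \<Rightarrow> nat) \<Rightarrow> (nat \<Rightarrow> cantor \<Rightarrow> bool) \<Rightarrow> cantor" where
  "tabulate l D m =
    (let n = fst (prod_decode m);
         b = fst (prod_decode (snd (prod_decode m)));
         c = snd (prod_decode (snd (prod_decode m)))
     in (2 ^ l n \<le> Suc c \<and> Suc c < 2 ^ Suc (l n)) \<and> ((b = 1) = D n (bit (Suc c))))"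

text \<open>Only the prefix of length \<open>l n\<close> speaks about digit \<open>n\<close>, and it
  does so for one value of \<open>b\<close>, so no conflict arises. The digits of
  \<open>Suc c\<close> agree with \<open>x\<close> below \<open>l n\<close>, which is as far as
  \<open>D n\<close> looks.\<close>

lemma associate_fun_tabulate:
  assumes D: "\<And>n. depends_below (l n) (D n)"
  shows "associate_fun (tabulate l D) x = Some (\<lambda>n. D n x)"
proof -
  have "tabulate l D (info_code n b (prefix_word x k)) \<longleftrightarrow> k = l n \<and> b = D n x" for n b k
  proof -
    have "D n (bit (Suc (word_code (prefix_word x (l n))))) = D n x"
      by (rule depends_belowD[OF D]) (simp add: bit_word_code prefix_word_def)
    moreover have "length (prefix_word x k) = k" by (simp add: prefix_word_def)
    moreover have "(of_bool b = (1::nat)) = b" by simp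
    ultimately show ?thesis
      unfolding tabulate_def info_code_def Let_def prod_encode_inverse fst_conv snd_conv
        word_code_length
      by metis
  qed
  then have "says (tabulate l D) x n b \<longleftrightarrow> b = D n x" for n b
    unfolding says_def by auto
  then have "says (tabulate l D) x n = (\<lambda>b. b = D n x)" for n by blast
  then show ?thesis unfolding associate_fun_def by simp
qed

section \<open>Coding points by the clopen sets containing them\<close>

text \<open>\<open>clopen_code x i\<close> says whether \<open>x\<close> lies in the \<open>i\<close>-th clopen set: the subbasic set \<open>x n = 1\<close> for
  \<open>i = (n, 0)\<close>, and the complement of the cylinder of the word of length \<open>n\<close> with code \<open>a\<close> for
  \<open>i = (n, Suc a)\<close>.\<close>

definition clopen_code :: "cantor \<Rightarrow> cantor" where
  "clopen_code x i \<longleftrightarrow>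
    snd (prod_decode i) = 0 \<and> x (fst (prod_decode i)) \<or>
    snd (prod_decode i) \<noteq> 0 \<and>
      Suc (word_code (prefix_word x (fst (prod_decode i)))) \<noteq> snd (prod_decode i)"

text \<open>The purpose of listing the subbasic sets: a point can be read off its code, which gives
  injectivity and a computable decoding.\<close>

lemma clopen_code_digit: "clopen_code x (prod_encode (n, 0)) = x n"
  by (simp add: clopen_code_def)

lemma clopen_code_word:
  "clopen_code x (prod_encode (n, Suc (word_code (prefix_word y n)))) \<longleftrightarrow> (\<exists>i<n. x i \<noteq> y i)"
  by (simp add: clopen_code_def word_code_inj prefix_word_eq_iff)

lemma inj_clopen_code: "inj clopen_code"
  by (intro injI ext) (metis clopen_code_digit)

text \<open>The first component of the pair \<open>i\<close> is at most \<open>i\<close>. A subbasic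
  set inspects the coordinate with exactly that index, whence the bound
  \<open>Suc i\<close>.\<close>

lemma depends_below_clopen_code: "depends_below (Suc i) (\<lambda>x. clopen_code x i)"
proof (rule depends_belowI)
  fix x y :: cantor assume eq: "\<And>j. j < Suc i \<Longrightarrow> x j = y j"
  have "fst (prod_decode i) \<le> i"
    by (metis le_prod_encode_1 prod.collapse prod_decode_inverse)
  then have "x (fst (prod_decode i)) = y (fst (prod_decode i))"
    "prefix_word x (fst (prod_decode i)) = prefix_word y (fst (prod_decode i))"
    using eq by (auto simp: prefix_word_eq_iff)
  then show "clopen_code x i = clopen_code y i" by (simp add: clopen_code_def)
qed

text \<open>\<open>X\<close> is asked for at a bound variable, for the prefixes, and at the
  coordinate read by a subbasic set, so that the closure rules can treat both by plain
  unification.\<close>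

lemma decidable_clopen_code [rec_intros]:
  assumes "decidable (Suc k) (\<lambda>p ys. X p (hd ys) (tl ys))" "recursive k f"
    "decidable k (\<lambda>p xs. X p (fst (prod_decode (f p xs))) xs)"
  shows "decidable k (\<lambda>p xs. clopen_code (\<lambda>j. X p j xs) (f p xs))"
  unfolding clopen_code_def by (intro rec_intros assms)

definition clopen_name :: "nat \<Rightarrow> cantor" where
  "clopen_name i = tabulate (\<lambda>_. Suc i) (\<lambda>_ x. clopen_code x i)"

lemma open_rep_clopen_name: "open_rep cantor_rep (clopen_name i) = Some {x. clopen_code x i}"
  unfolding open_rep_eq_Some clopen_name_def
  by (auto simp: associate_fun_tabulate depends_below_clopen_code cantor_rep_def ran_def)

text \<open>A point outside \<open>A\<close> has a cylinder that misses \<open>A\<close>. The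
  complement of this cylinder is among the listed sets, contains \<open>A\<close> and omits the
  point.\<close>

lemma closed_eq_Inter_clopen:
  assumes "closed A"
  shows "x \<in> A \<longleftrightarrow> (\<forall>i. (\<forall>y\<in>A. clopen_code y i) \<longrightarrow> clopen_code x i)"
proof
  assume *: "\<forall>i. (\<forall>y\<in>A. clopen_code y i) \<longrightarrow> clopen_code x i"
  show "x \<in> A"
  proof (rule ccontr)
    assume "x \<notin> A"
    then obtain n where n: "\<forall>y. (\<forall>i<n. y i = x i) \<longrightarrow> y \<in> - A"
      using open_cantor_contains_cylinder[of "- A" x] assms by (auto simp: open_closed)
    then have "\<forall>y\<in>A. clopen_code y (prod_encode (n, Suc (word_code (prefix_word x n))))"
      by (auto simp: clopen_code_word)
    then have "clopen_code x (prod_encode (n, Suc (word_code (prefix_word x n))))"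
      using * by blast
    then show False by (simp add: clopen_code_word)
  qed
qed blast

text \<open>Every listed clopen set has a name, so sets with the same represented neighbourhoods lie
  in the same listed clopen sets and, being closed, coincide. Hence the description in
  \<open>compact_rep\<close> is unique.\<close>

lemma compact_rep_eq_Some:
  "compact_rep p = Some A \<longleftrightarrow> compact A \<and>
    (\<forall>r U. open_rep cantor_rep r = Some U \<longrightarrow>
      (\<exists>s. associate_fun p r = Some s \<and> (\<exists>n. s n) = (A \<subseteq> U)))"
proof -
  define names where "names A \<longleftrightarrow> compact A \<and>
      open_rep (open_rep cantor_rep) p = Some {U \<in> ran (open_rep cantor_rep). A \<subseteq> U}" for A
  have ran: "{x. clopen_code x i} \<in> ran (open_rep cantor_rep)" for i
    using open_rep_clopen_name by (auto simp: ran_def)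
  have unique: "A = B" if "names A" "names B" for A B
  proof -
    have "{U \<in> ran (open_rep cantor_rep). A \<subseteq> U} = {U \<in> ran (open_rep cantor_rep). B \<subseteq> U}"
      using that by (simp add: names_def)
    then have iff: "A \<subseteq> U \<longleftrightarrow> B \<subseteq> U" if "U \<in> ran (open_rep cantor_rep)" for U
      using that by blast
    have "(\<forall>y\<in>A. clopen_code y i) \<longleftrightarrow> (\<forall>y\<in>B. clopen_code y i)" for i
      using iff[OF ran[of i]] by blast
    moreover have "closed A" "closed B" using that by (auto simp: names_def compact_cantor_iff_closed)
    ultimately have "x \<in> A \<longleftrightarrow> x \<in> B" for x
      using closed_eq_Inter_clopen[of A x] closed_eq_Inter_clopen[of B x] by simp
    then show ?thesis by blast
  qed
  have rep: "compact_rep p = (if \<exists>A. names A then Some (THE A. names A) else None)"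
    unfolding compact_rep_def Let_def names_def ..
  have the: "(THE A. names A) = A" if "names A" for A
    by (rule the_equality[where P = names]) (rule that, rule unique[OF _ that])
  have "compact_rep p = Some A \<longleftrightarrow> names A"
  proof (cases "\<exists>A. names A")
    case True
    then obtain B where B: "names B" by blast
    have "compact_rep p = Some B" unfolding rep if_P[OF True] the[OF B] ..
    then show ?thesis using B unique by (metis option.inject)
  next
    case False
    then show ?thesis unfolding rep if_not_P[OF False] by (metis option.distinct(1))
  qed
  also have "\<dots> \<longleftrightarrow> compact A \<and>
    (\<forall>r U. open_rep cantor_rep r = Some U \<longrightarrow>
      (\<exists>s. associate_fun p r = Some s \<and> (\<exists>n. s n) = (A \<subseteq> U)))"
  proof -
    let ?N = "{U \<in> ran (open_rep cantor_rep). A \<subseteq> U}"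
    \<comment> \<open>A set with a name lies in the range, so membership in \<open>?N\<close>
      reduces to the inclusion.\<close>
    have N: "((\<exists>n. s n) = (U \<in> ?N)) = ((\<exists>n. s n) = (A \<subseteq> U))"
      if "open_rep cantor_rep r = Some U" for r U and s :: cantor
      using ranI[where m = "open_rep cantor_rep", OF that] by simp
    have sub: "?N \<subseteq> ran (open_rep cantor_rep)" by blast
    show ?thesis
      unfolding names_def open_rep_eq_Some[of "open_rep cantor_rep"]
      by (simp only: sub simp_thms) (intro all_cong1 ex_cong1 imp_cong conj_cong refl N)
  qed
  finally show ?thesis .
qed

section \<open>The matching representations\<close>

text \<open>Every point has exactly one name, so the quantifier over \<open>q\<close> in the
  matching property collapses to the single candidate \<open>clopen_code x\<close>.\<close>

definition point_rep :: "cantor \<rightharpoonup> cantor" where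
  "point_rep q = (if q \<in> range clopen_code then Some (inv clopen_code q) else None)"

lemma point_rep_eq_Some: "point_rep q = Some x \<longleftrightarrow> q = clopen_code x"
  unfolding point_rep_def using inj_clopen_code by (auto simp: inv_f_f)

lemma computably_equivalent_point_rep: "computably_equivalent point_rep cantor_rep"
proof -
  have "computable (\<lambda>q. Some (\<lambda>n. q (prod_encode (n, 0))))"
    by (rule computable_if_decidable) (intro rec_intros)
  moreover have "realizes (\<lambda>q. Some (\<lambda>n. q (prod_encode (n, 0)))) point_rep cantor_rep id"
    by (auto simp: realizes_def point_rep_eq_Some cantor_rep_def clopen_code_digit)
  moreover have "computable (\<lambda>x. Some (clopen_code x))"
    by (rule computable_if_decidable) (intro rec_intros)
  moreover have "realizes (\<lambda>x. Some (clopen_code x)) cantor_rep point_rep id"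
    by (auto simp: realizes_def point_rep_eq_Some cantor_rep_def)
  ultimately show ?thesis unfolding computably_equivalent_def computable_map_def by blast
qed

definition compact_of :: "plotkin_seq \<Rightarrow> cantor set" where
  "compact_of p = {x. p \<preceq> plotkin_of_cantor (clopen_code x)}"

lemma mem_compact_of: "x \<in> compact_of p \<longleftrightarrow> (\<forall>i b. p i = Some b \<longrightarrow> b = clopen_code x i)"
  by (auto simp: compact_of_def plotkin_le_def plotkin_of_cantor_def)

lemma compact_compact_of: "compact (compact_of p)"
proof -
  have "depends_below (Suc i) (\<lambda>x. p i = Some b \<longrightarrow> b = clopen_code x i)" for i b
    using depends_below_clopen_code[of i] by (auto simp: depends_below_def)
  then have "closed (\<Inter>i b. {x. p i = Some b \<longrightarrow> b = clopen_code x i})"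
    by (intro closed_INT ballI depends_below_closed)
  moreover have "(\<Inter>i b. {x. p i = Some b \<longrightarrow> b = clopen_code x i}) = compact_of p"
    by (auto simp: mem_compact_of)
  ultimately show ?thesis by (simp add: compact_cantor_iff_closed)
qed

text \<open>Only 1 and bottom occur, since a name of \<open>A\<close> confirms an inclusion in an
  open set by finitely much information. For empty \<open>A\<close> all digits are 1, and no point
  meets all these conditions.\<close>

definition negative_info :: "cantor set \<Rightarrow> plotkin_seq" where
  "negative_info A i = (if \<forall>y\<in>A. clopen_code y i then Some True else None)"

lemma compact_of_negative_info:
  assumes "compact A"
  shows "compact_of (negative_info A) = A"
proof (rule set_eqI)
  fix x
  have "x \<in> compact_of (negative_info A) \<longleftrightarrow>
      (\<forall>i. (\<forall>y\<in>A. clopen_code y i) \<longrightarrow> clopen_code x i)"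
    by (auto simp: mem_compact_of negative_info_def)
  also have "\<dots> \<longleftrightarrow> x \<in> A"
    using assms closed_eq_Inter_clopen by (simp only: compact_cantor_iff_closed)
  finally show "x \<in> compact_of (negative_info A) \<longleftrightarrow> x \<in> A" .
qed

text \<open>Replaces the least position of a 1 by a witness whose minimality is a bounded condition,
  the form used in \<open>covered\<close>.\<close>

lemma plotkin_seq_rep_eq_Some:
  "plotkin_seq_rep p i = Some b \<longleftrightarrow>
    (\<exists>k. p (prod_encode (i, k)) \<and> (\<forall>j<k. \<not> p (prod_encode (i, j))) \<and> odd k = b)"
proof
  assume "plotkin_seq_rep p i = Some b"
  then have ex: "\<exists>k. p (prod_encode (i, k))" and odd: "odd (LEAST k. p (prod_encode (i, k))) = b"
    by (auto simp: plotkin_seq_rep_def plotkin_rep_def split: if_splits)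
  then show "\<exists>k. p (prod_encode (i, k)) \<and> (\<forall>j<k. \<not> p (prod_encode (i, j))) \<and> odd k = b"
    by (metis LeastI_ex not_less_Least)
next
  assume "\<exists>k. p (prod_encode (i, k)) \<and> (\<forall>j<k. \<not> p (prod_encode (i, j))) \<and> odd k = b"
  then obtain k where k: "p (prod_encode (i, k))" "\<forall>j<k. \<not> p (prod_encode (i, j))" "odd k = b"
    by blast
  then have "(LEAST k. p (prod_encode (i, k))) = k" by (metis Least_equality not_le)
  then show "plotkin_seq_rep p i = Some b"
    using k by (auto simp: plotkin_seq_rep_def plotkin_rep_def)
qed

section \<open>From sequences over Plotkin's T to standard names of compact sets\<close>

text \<open>\<open>covered p n r x\<close>: within \<open>n\<close> steps, either \<open>p\<close> has revealed that \<open>x\<close> is outside the compact set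
  named by \<open>p\<close>, or \<open>r\<close> has revealed that \<open>x\<close> is inside the open set named by \<open>r\<close>. Only the first
  \<open>n\<close> digits of \<open>x\<close> and \<open>r\<close> matter, so that \<open>all_covered\<close> may test the finitely many binary expansions
  \<open>bit a\<close> in place of all points.\<close>

definition covered :: "cantor \<Rightarrow> nat \<Rightarrow> cantor \<Rightarrow> cantor \<Rightarrow> bool" where
  "covered p n r x \<longleftrightarrow>
    (\<exists>i<n. \<exists>k<n. p (prod_encode (i, k)) \<and> (\<forall>j<k. \<not> p (prod_encode (i, j))) \<and>
       \<not> (odd k \<longleftrightarrow> clopen_code x i)) \<or>
    (\<exists>m<n. \<exists>k<n. prod_encode (m, prod_encode (1, word_code (prefix_word x k))) < n \<and>
       r (prod_encode (m, prod_encode (1, word_code (prefix_word x k)))))"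

definition all_covered :: "cantor \<Rightarrow> nat \<Rightarrow> cantor \<Rightarrow> bool" where
  "all_covered p n r \<longleftrightarrow> (\<forall>a<2 ^ n. covered p n r (bit (a::nat)))"

lemma depends_below_covered: "depends_below n (covered p n r)"
proof (rule depends_belowI)
  fix x y :: cantor assume eq: "\<And>j. j < n \<Longrightarrow> x j = y j"
  have "clopen_code x i = clopen_code y i" if "i < n" for i
    using that by (intro depends_belowD[OF depends_below_clopen_code] eq) simp
  moreover have "prefix_word x k = prefix_word y k" if "k < n" for k
    using that eq by (auto simp: prefix_word_eq_iff)
  ultimately show "covered p n r x = covered p n r y"
    unfolding covered_def by (simp cong: conj_cong)
qed

text \<open>Here the varying argument is the name \<open>r\<close> of the open set; the guard on the
  information code in \<open>covered\<close> keeps every consulted position below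
  \<open>n\<close>.\<close>

lemma depends_below_all_covered: "depends_below n (all_covered p n)"
  by (rule depends_belowI) (simp add: all_covered_def covered_def cong: conj_cong)

lemma all_covered_iff: "all_covered p n r \<longleftrightarrow> (\<forall>x. covered p n r x)"
proof
  assume *: "all_covered p n r"
  show "\<forall>x. covered p n r x"
  proof
    fix x
    obtain a :: nat where a: "a < 2 ^ n" "\<forall>i<n. bit a i = x i" using ex_nat_bits by blast
    have "covered p n r (bit a) = covered p n r x"
      using a(2) by (intro depends_belowD[OF depends_below_covered]) simp
    then show "covered p n r x" using * a(1) by (simp add: all_covered_def)
  qed
qed (simp add: all_covered_def)

lemma covered_mono: "m \<le> n \<Longrightarrow> covered p m r x \<Longrightarrow> covered p n r x"
  unfolding covered_def by (meson less_le_trans)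

lemma ex_all_covered_iff:
  assumes r: "open_rep cantor_rep r = Some U"
  shows "(\<exists>n. all_covered p n r) \<longleftrightarrow> compact_of (plotkin_seq_rep p) \<subseteq> U"
proof -
  have covered: "(\<exists>n. covered p n r x) \<longleftrightarrow> x \<notin> compact_of (plotkin_seq_rep p) \<or> x \<in> U" for x
  proof
    assume "\<exists>n. covered p n r x"
    then show "x \<notin> compact_of (plotkin_seq_rep p) \<or> x \<in> U"
      unfolding covered_def mem_compact_of plotkin_seq_rep_eq_Some open_rep_cantor_says[OF r]
        says_def info_code_def by auto
  next
    assume "x \<notin> compact_of (plotkin_seq_rep p) \<or> x \<in> U"
    then consider i k where "p (prod_encode (i, k))" "\<forall>j<k. \<not> p (prod_encode (i, j))"
        "\<not> (odd k \<longleftrightarrow> clopen_code x i)"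
      | m k where "r (prod_encode (m, prod_encode (1, word_code (prefix_word x k))))"
      unfolding mem_compact_of plotkin_seq_rep_eq_Some open_rep_cantor_says[OF r]
        says_def info_code_def by auto
    then show "\<exists>n. covered p n r x"
    proof cases
      case (1 i k)
      then have "covered p (Suc (i + k)) r x"
        unfolding covered_def by (intro disjI1 exI[of _ i] exI[of _ k] conjI) auto
      then show ?thesis ..
    next
      case (2 m k)
      \<comment> \<open>The stage exceeds the output digit, the prefix length and the information
        code, all of which \<open>covered\<close> bounds.\<close>
      then have "covered p
          (Suc (m + k + prod_encode (m, prod_encode (1, word_code (prefix_word x k))))) r x"
        unfolding covered_def by (intro disjI2 exI[of _ m] exI[of _ k] conjI) auto
      then show ?thesis ..
    qed
  qed
  show ?thesis
  proof
    assume "\<exists>n. all_covered p n r"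
    then show "compact_of (plotkin_seq_rep p) \<subseteq> U" using covered by (auto simp: all_covered_iff)
  next
    assume "compact_of (plotkin_seq_rep p) \<subseteq> U"
    then have "UNIV \<subseteq> (\<Union>n. {x. covered p n r x})" using covered by blast
    then obtain N where N: "finite N" "UNIV \<subseteq> (\<Union>n\<in>N. {x. covered p n r x})"
      using compactE_image[OF compact_cantor, of UNIV "\<lambda>n. {x. covered p n r x}"]
        depends_below_open[OF depends_below_covered] by auto
    \<comment> \<open>The stages increase, so the last one of the finite subcover already covers the
      whole space.\<close>
    have "covered p (Max N) r x" for x
      using N covered_mono[OF Max_ge[OF N(1)]] by blast
    then show "\<exists>n. all_covered p n r" by (auto simp: all_covered_iff)
  qed
qed

text \<open>Digit \<open>n\<close> of the Sierpinski output is the outcome of stage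
  \<open>n\<close>, so the output is top iff some stage succeeds. Stage \<open>n\<close> reads
  \<open>n\<close> digits of \<open>r\<close>, whence the word length \<open>n\<close>.\<close>

definition compact_name :: "cantor \<Rightarrow> cantor" where
  "compact_name p = tabulate (\<lambda>n. n) (all_covered p)"

lemma compact_rep_compact_name:
  "compact_rep (compact_name p) = Some (compact_of (plotkin_seq_rep p))"
  unfolding compact_rep_eq_Some compact_name_def
  by (simp add: compact_compact_of associate_fun_tabulate[OF depends_below_all_covered]
      ex_all_covered_iff)

lemma computable_compact_name: "computable (\<lambda>p. Some (compact_name p))"
proof (rule computable_if_decidable)
  show "decidable (Suc 0) (\<lambda>p ys. compact_name p (hd ys))"
    unfolding compact_name_def tabulate_def all_covered_def covered_def Let_def
    by (intro rec_intros)
qed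

section \<open>From standard names of compact sets to sequences over Plotkin's T\<close>

definition negative_info_name :: "cantor \<Rightarrow> cantor" where
  "negative_info_name p m \<longleftrightarrow>
    odd (snd (prod_decode m)) \<and>
    p (prod_encode (fst (prod_decode (snd (prod_decode m) div 2)),
         prod_encode (1, word_code (prefix_word (clopen_name (fst (prod_decode m)))
           (snd (prod_decode (snd (prod_decode m) div 2)))))))"

text \<open>Half of a position enumerates the pairs of an output digit and a prefix length, at which
  \<open>p\<close> is applied to \<open>clopen_name i\<close>. Ones are written at odd positions
  only, so the first one, if any, denotes the value 1.\<close>

lemma plotkin_seq_rep_negative_info_name:
  assumes "compact_rep p = Some A"
  shows "plotkin_seq_rep (negative_info_name p) = negative_info A"
proof
  fix i
  obtain s where s: "associate_fun p (clopen_name i) = Some s"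
    "(\<exists>n. s n) \<longleftrightarrow> A \<subseteq> {x. clopen_code x i}"
    using assms open_rep_clopen_name unfolding compact_rep_eq_Some by blast
  have name: "negative_info_name p (prod_encode (i, Suc (2 * prod_encode (n, k)))) \<longleftrightarrow>
      p (info_code n True (prefix_word (clopen_name i) k))" for n k
    by (simp add: negative_info_name_def info_code_def)
  have odd: "negative_info_name p (prod_encode (i, k)) \<Longrightarrow> odd k" for k
    by (simp add: negative_info_name_def)
  have "(\<exists>k. negative_info_name p (prod_encode (i, k))) \<longleftrightarrow>
      (\<exists>n k. negative_info_name p (prod_encode (i, Suc (2 * prod_encode (n, k)))))"
    by (metis odd Suc_eq_plus1 oddE prod.collapse prod_decode_inverse)
  also have "\<dots> \<longleftrightarrow> (\<exists>n. says p (clopen_name i) n True)"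
    by (simp add: name says_def)
  also have "\<dots> \<longleftrightarrow> A \<subseteq> {x. clopen_code x i}"
    using s by (simp add: associate_fun_eq_Some_says)
  finally have "(\<exists>k. negative_info_name p (prod_encode (i, k))) \<longleftrightarrow> (\<forall>y\<in>A. clopen_code y i)"
    by auto
  moreover have "odd (LEAST k. negative_info_name p (prod_encode (i, k)))"
    if "\<exists>k. negative_info_name p (prod_encode (i, k))"
    using that by (intro odd) (rule LeastI_ex)
  ultimately show "plotkin_seq_rep (negative_info_name p) i = negative_info A i"
    by (auto simp: plotkin_seq_rep_def plotkin_rep_def negative_info_def)
qed

lemma computable_negative_info_name: "computable (\<lambda>p. Some (negative_info_name p))"
proof (rule computable_if_decidable)
  show "decidable (Suc 0) (\<lambda>p ys. negative_info_name p (hd ys))"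
    unfolding negative_info_name_def clopen_name_def tabulate_def Let_def
    by (intro rec_intros)
qed

theorem theorem9:
  shows "\<exists>(\<delta> :: cantor \<rightharpoonup> cantor) (\<psi> :: plotkin_seq \<rightharpoonup> cantor set).
    ran \<delta> = UNIV \<and> computably_equivalent \<delta> cantor_rep \<and>
    ran \<psi> = {A. compact A} \<and> computably_equivalent (\<psi> \<circ> plotkin_seq_rep) compact_rep \<and>
    (\<forall>A x. compact A \<longrightarrow>
      (x \<in> A \<longleftrightarrow> (\<forall>p. \<psi> p = Some A \<longrightarrow> (\<exists>q. p \<preceq> plotkin_of_cantor q \<and> \<delta> q = Some x))) \<and>
      ((\<forall>p. \<psi> p = Some A \<longrightarrow> (\<exists>q. p \<preceq> plotkin_of_cantor q \<and> \<delta> q = Some x)) \<longleftrightarrow>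
       (\<exists>p. \<psi> p = Some A \<and> (\<exists>q. p \<preceq> plotkin_of_cantor q \<and> \<delta> q = Some x))))"
proof -
  let ?\<psi> = "\<lambda>p. Some (compact_of p)"
  have surj: "\<exists>p. compact_of p = A" if "compact A" for A
    using compact_of_negative_info[OF that] by blast
  have ran_\<delta>: "ran point_rep = UNIV" by (auto simp: ran_def point_rep_eq_Some)
  have ran_\<psi>: "ran ?\<psi> = {A. compact A}"
    using compact_compact_of surj by (fastforce simp: ran_def)
  have equiv_\<psi>: "computably_equivalent (?\<psi> \<circ> plotkin_seq_rep) compact_rep"
    unfolding computably_equivalent_def computable_map_def
  proof
    have "realizes (\<lambda>p. Some (compact_name p)) (?\<psi> \<circ> plotkin_seq_rep) compact_rep id"
      by (auto simp: realizes_def compact_rep_compact_name)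
    then show "\<exists>F. computable F \<and> realizes F (?\<psi> \<circ> plotkin_seq_rep) compact_rep id"
      using computable_compact_name by blast
    have "realizes (\<lambda>p. Some (negative_info_name p)) compact_rep (?\<psi> \<circ> plotkin_seq_rep) id"
      using plotkin_seq_rep_negative_info_name compact_of_negative_info
      by (auto simp: realizes_def compact_rep_eq_Some)
    then show "\<exists>F. computable F \<and> realizes F compact_rep (?\<psi> \<circ> plotkin_seq_rep) id"
      using computable_negative_info_name by blast
  qed
  have match: "(x \<in> A \<longleftrightarrow>
        (\<forall>p. ?\<psi> p = Some A \<longrightarrow> (\<exists>q. p \<preceq> plotkin_of_cantor q \<and> point_rep q = Some x))) \<and>
      ((\<forall>p. ?\<psi> p = Some A \<longrightarrow> (\<exists>q. p \<preceq> plotkin_of_cantor q \<and> point_rep q = Some x)) \<longleftrightarrow>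
       (\<exists>p. ?\<psi> p = Some A \<and> (\<exists>q. p \<preceq> plotkin_of_cantor q \<and> point_rep q = Some x)))"
    if "compact A" for A x
  proof -
    have "(\<exists>q. p \<preceq> plotkin_of_cantor q \<and> point_rep q = Some x) \<longleftrightarrow> x \<in> compact_of p" for p
      by (simp add: point_rep_eq_Some compact_of_def)
    \<comment> \<open>The inner condition depends on \<open>p\<close> only through
      \<open>compact_of p = A\<close>, and \<open>surj\<close> provides such a \<open>p\<close>, so
      the universal statement is not vacuous.\<close>
    then show ?thesis unfolding option.inject using surj[OF that] by (simp only:) blast
  qed
  show ?thesis
    using match
    by (intro exI[of _ point_rep] exI[of _ ?\<psi>] conjI[OF ran_\<delta>]
        conjI[OF computably_equivalent_point_rep] conjI[OF ran_\<psi>] conjI[OF equiv_\<psi>] allI impI)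
qed

end
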